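(* Let $\Gamma=(G,\sigma)$ be a signed graph on $N$ vertices. Then $$\frac{2-\lambda_N(\Delta^{\sigma})}{2}\leq \widetilde{h}^{\sigma}_1(\mu_d)\leq \sqrt{2(2-\lambda_N(\Delta^{\sigma}))}.$$
   Context: A signed graph $\Gamma=(G,\sigma)$ consists of a finite simple undirected graph $G=(V,E)$ with $N=|V|$ vertices, positive symmetric edge weights $w_{uv}>0$ for $\{u,v\}\in E$ ($w_{uv}=0$ otherwise), and a signature $\sigma:E\to\{+1,-1\}$; write $\sigma(uv)=\sigma(\{u,v\})$. The degree is $d_u=\sum_v w_{uv}$ (assumed positive). $D=\mathrm{diag}(d_u)$, $A^{\sigma}_{uv}=\sigma(uv)w_{uv}$ for edges and $0$ otherwise, $\Delta^{\sigma}=I-D^{-1}A^{\sigma}$, with eigenvalues $0\le\lambda_1(\Delta^\sigma)\le\cdots\le\lambda_N(\Delta^\sigma)\le2$. For a positive measure $\mu$ on $V$, $\mathrm{vol}_\mu(S)=\sum_{u\in S}\mu(u)$; $\mu_d(u)=d_u$. For $V_1,V_2\subseteq V$, $|E(V_1,V_2)|=\sum_{u\in V_1}\sum_{v\in V_2}w_{uv}$, $|E^{\pm}(V_1,V_2)|=\sum_{u\in V_1}\sum_{v\in V_2,\sigma(uv)=\pm1}w_{uv}$, $|E^\pm(V_1)|=|E^\pm(V_1,V_1)|$. For disjoint $V_1,V_2$ with $V_1\cup V_2\ne\emptyset$, $$\beta^{\sigma}(V_1,V_2)=\frac{2|E^{+}(V_1,V_2)|+|E^-(V_1)|+|E^-(V_2)|+|E(V_1\cup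 V_2,\overline{V_1\cup V_2})|}{\mathrm{vol}_{\mu}(V_1\cup V_2)},$$ $h_1^\sigma(\mu)$ is the minimum of $\beta^\sigma$ over all such pairs, and the dual signed Cheeger constant is $\widetilde h_1^{\sigma}(\mu):=h_1^{-\sigma}(\mu)$, computed for the negated signature $-\sigma$. *)

theory Defs
  imports "HOL-Analysis.Analysis" "HOL-Computational_Algebra.Computational_Algebra"
begin

text \<open>
  The vertex set is the finite type \<open>'v\<close>, so \<open>N = CARD('v)\<close>.  An edge is a two-element set of
  vertices.  Values of \<open>\<sigma>\<close> outside \<open>E\<close> are irrelevant.
\<close>

definition wdegree :: "('v::finite \<Rightarrow> 'v \<Rightarrow> real) \<Rightarrow> 'v \<Rightarrow> real" where
  "wdegree w u = (\<Sum>v\<in>UNIV. w u v)"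

locale signed_graph =
  fixes E :: "'v::finite set set"
    and w :: "'v \<Rightarrow> 'v \<Rightarrow> real"
    and \<sigma> :: "'v set \<Rightarrow> int"
  assumes edge_card: "e \<in> E \<Longrightarrow> card e = 2"
    and weight_sym: "w u v = w v u"
    and weight_pos: "{u, v} \<in> E \<Longrightarrow> w u v > 0"
    and weight_nonedge: "{u, v} \<notin> E \<Longrightarrow> w u v = 0"
    and sign_values: "e \<in> E \<Longrightarrow> \<sigma> e \<in> {1, -1}"
    and degree_pos: "wdegree w u > 0"

definition signed_adjacency ::
    "'v::finite set set \<Rightarrow> ('v \<Rightarrow> 'v \<Rightarrow> real) \<Rightarrow> ('v set \<Rightarrow> int) \<Rightarrow> real^'v^'v" where
  "signed_adjacency E w \<sigma> =
     (\<chi> u v. if {u, v} \<in> E then of_int (\<sigma> {u, v}) * w u v else 0)"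

definition degree_matrix :: "('v::finite \<Rightarrow> 'v \<Rightarrow> real) \<Rightarrow> real^'v^'v" where
  "degree_matrix w = (\<chi> u v. if u = v then wdegree w u else 0)"

definition signed_laplacian ::
    "'v::finite set set \<Rightarrow> ('v \<Rightarrow> 'v \<Rightarrow> real) \<Rightarrow> ('v set \<Rightarrow> int) \<Rightarrow> real^'v^'v" where
  "signed_laplacian E w \<sigma> = mat 1 - matrix_inv (degree_matrix w) ** signed_adjacency E w \<sigma>"

definition charpoly :: "real^'n^'n \<Rightarrow> real poly" where
  "charpoly M = det (\<chi> i j. (if i = j then [:0, 1:] else 0) - [:M $ i $ j:])"

text \<open>
  The real eigenvalues, counted with algebraic multiplicity, in increasing order;
  \<open>eigval k M\<close> is the \<open>k\<close>-th one, with \<open>k\<close> starting at 1.  For the signed Laplacian (similar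
  to a symmetric matrix) all \<open>N\<close> eigenvalues are real, so \<open>k\<close> ranges over \<open>1, \<dots>, N\<close>.
\<close>

definition eigval :: "nat \<Rightarrow> real^'n^'n \<Rightarrow> real" where
  "eigval k M = sorted_list_of_multiset (proots (charpoly M)) ! (k - 1)"

definition vol :: "('v \<Rightarrow> real) \<Rightarrow> 'v set \<Rightarrow> real" where
  "vol \<mu> S = (\<Sum>u\<in>S. \<mu> u)"

definition edge_weight :: "('v \<Rightarrow> 'v \<Rightarrow> real) \<Rightarrow> 'v set \<Rightarrow> 'v set \<Rightarrow> real" where
  "edge_weight w V1 V2 = (\<Sum>u\<in>V1. \<Sum>v\<in>V2. w u v)"

text \<open>\<open>s = 1\<close> and \<open>s = -1\<close> give the weights of positive and negative edges; edges with both
  endpoints in \<open>V1 \<inter> V2\<close> are counted twice.\<close>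

definition edge_weight_sign ::
    "'v set set \<Rightarrow> ('v \<Rightarrow> 'v \<Rightarrow> real) \<Rightarrow> ('v set \<Rightarrow> int) \<Rightarrow> int \<Rightarrow> 'v set \<Rightarrow> 'v set \<Rightarrow> real" where
  "edge_weight_sign E w \<sigma> s V1 V2 =
     (\<Sum>u\<in>V1. \<Sum>v\<in>{v\<in>V2. {u, v} \<in> E \<and> \<sigma> {u, v} = s}. w u v)"

definition \<beta> ::
    "'v::finite set set \<Rightarrow> ('v \<Rightarrow> 'v \<Rightarrow> real) \<Rightarrow> ('v set \<Rightarrow> int) \<Rightarrow> ('v \<Rightarrow> real)
      \<Rightarrow> 'v set \<Rightarrow> 'v set \<Rightarrow> real" where
  "\<beta> E w \<sigma> \<mu> V1 V2 =
     (2 * edge_weight_sign E w \<sigma> 1 V1 V2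
        + edge_weight_sign E w \<sigma> (-1) V1 V1
        + edge_weight_sign E w \<sigma> (-1) V2 V2
        + edge_weight w (V1 \<union> V2) (- (V1 \<union> V2)))
     / vol \<mu> (V1 \<union> V2)"

definition signed_cheeger ::
    "'v::finite set set \<Rightarrow> ('v \<Rightarrow> 'v \<Rightarrow> real) \<Rightarrow> ('v set \<Rightarrow> int) \<Rightarrow> ('v \<Rightarrow> real) \<Rightarrow> real" where
  "signed_cheeger E w \<sigma> \<mu> =
     Min {\<beta> E w \<sigma> \<mu> V1 V2 | V1 V2. V1 \<inter> V2 = {} \<and> V1 \<union> V2 \<noteq> {}}"

definition dual_signed_cheeger ::
    "'v::finite set set \<Rightarrow> ('v \<Rightarrow> 'v \<Rightarrow> real) \<Rightarrow> ('v set \<Rightarrow> int) \<Rightarrow> ('v \<Rightarrow> real) \<Rightarrow> real" where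
  "dual_signed_cheeger E w \<sigma> \<mu> = signed_cheeger E w (\<lambda>e. - \<sigma> e) \<mu>"

end

theory Submission
  imports Defs
begin

text \<open>
  Up to the factor \<open>2\<close> coming from ordered pairs, \<open>2 - \<lambda>\<^sub>N\<close> is the minimum over \<open>x \<noteq> 0\<close> of the quotient
  of \<open>\<Sum> w u v * (x u + \<sigma> u v * x v)\<^sup>2\<close> by \<open>\<Sum> d u * (x u)\<^sup>2\<close>.  Testing it with
  \<open>1\<close> on \<open>V1\<close>, \<open>-1\<close> on \<open>V2\<close> and \<open>0\<close> elsewhere gives the lower bound.  For the upper bound take an eigenvector
  \<open>x\<close> of \<open>\<lambda>\<^sub>N\<close>, average the Cheeger inequality over the pairs of level sets
  \<open>V1 = {x > 0, x\<^sup>2 > t}\<close>, \<open>V2 = {x < 0, x\<^sup>2 > t}\<close> for \<open>t \<ge> 0\<close>, and apply Cauchy-Schwarz.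

  Since \<open>eigval N\<close> selects the \<open>N\<close>-th entry of the sorted list of real roots, it is the largest
  eigenvalue only because the characteristic polynomial splits over the reals: its complex roots
  are real, the Laplacian being self-adjoint for the inner product weighted by the degrees.
\<close>

subsection \<open>The characteristic polynomial\<close>

lemma poly_det:
  "poly (det P) z = det (\<chi> i j. poly (P $ i $ j) z)"
  by (simp add: det_def poly_sum poly_prod)

text \<open>Ring homomorphisms commute with the Leibniz expansion. Applied to evaluation at a
  complex point, this turns the characteristic polynomial into a complex determinant.\<close>

lemma det_map_hom:
  fixes h :: "'a::comm_ring_1 \<Rightarrow> 'b::comm_ring_1" and A :: "'a^'n^'n"
  assumes "h 0 = 0" "h 1 = 1" "\<And>x. h (- x) = - h x"
    and "\<And>x y. h (x + y) = h x + h y" "\<And>x y. h (x * y) = h x * h y"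
  shows "h (det A) = det (\<chi> i j. h (A $ i $ j))"
proof -
  have "h (sum f S) = (\<Sum>x\<in>S. h (f x))" for f :: "('n \<Rightarrow> 'n) \<Rightarrow> 'a" and S
    by (induction S rule: infinite_finite_induct) (auto simp: assms)
  moreover have "h (prod f S) = (\<Prod>x\<in>S. h (f x))" for f :: "'n \<Rightarrow> 'a" and S
    by (induction S rule: infinite_finite_induct) (auto simp: assms)
  ultimately show ?thesis
    by (auto simp: det_def assms sign_def intro!: sum.cong)
qed

definition cpoly :: "real poly \<Rightarrow> complex \<Rightarrow> complex" where
  "cpoly p z = poly (map_poly of_real p) z"

lemma map_poly_of_real_add:
  "map_poly of_real (p + q) = map_poly of_real p + (map_poly of_real q :: complex poly)"
  by (intro poly_eqI) (simp add: coeff_map_poly)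

lemma map_poly_of_real_mult:
  "map_poly of_real (p * q) = map_poly of_real p * (map_poly of_real q :: complex poly)"
  by (intro poly_eqI) (simp add: coeff_map_poly coeff_mult)

lemma map_poly_of_real_uminus:
  "map_poly of_real (- p) = - (map_poly of_real p :: complex poly)"
  by (intro poly_eqI) (simp add: coeff_map_poly)

lemma cpoly_charpoly:
  "cpoly (charpoly M) z =
     det (\<chi> i j. (if i = j then z else 0) - complex_of_real (M $ i $ j))"
proof -
  have "cpoly (charpoly M) z = det (\<chi> i j. cpoly ((\<chi> i j. (if i = j then [:0, 1:] else 0) - [:M $ i $ j:]) $ i $ j) z)"
    unfolding charpoly_def
    by (rule det_map_hom)
      (simp_all add: cpoly_def map_poly_of_real_add map_poly_of_real_mult map_poly_of_real_uminus)
  also have "\<dots> = det (\<chi> i j. (if i = j then z else 0) - complex_of_real (M $ i $ j))"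
    by (rule arg_cong[of _ _ det]) (simp add: vec_eq_iff cpoly_def map_poly_pCons)
  finally show ?thesis .
qed

lemma poly_charpoly:
  "poly (charpoly M) t = det (\<chi> i j. (if i = j then t else 0) - M $ i $ j)"
  unfolding charpoly_def poly_det
  by (rule arg_cong[of _ _ det]) (simp add: vec_eq_iff)

text \<open>The matrix is \<open>t I - M\<close>, singular exactly when its kernel is nontrivial. A
  general field serves both the real eigenvalues and the complex roots.\<close>

lemma det_shift_eq_0_iff:
  fixes M :: "'a::field^'n^'n"
  shows "det (\<chi> i j. (if i = j then t else 0) - M $ i $ j) = 0 \<longleftrightarrow> (\<exists>x. x \<noteq> 0 \<and> M *v x = t *s x)"
proof -
  let ?A = "(\<chi> i j. (if i = j then t else 0) - M $ i $ j) :: 'a^'n^'n"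
  have *: "?A *v x = t *s x - M *v x" for x
    by (simp add: vec_eq_iff matrix_vector_mult_def left_diff_distrib sum_subtractf
        if_distrib[of "\<lambda>a. a * _"] cong: if_cong)
  have "det ?A = 0 \<longleftrightarrow> \<not> (\<forall>x. ?A *v x = 0 \<longrightarrow> x = 0)"
    using invertible_det_nz[of ?A] matrix_left_invertible_ker[of ?A]
    by (simp add: invertible_left_inverse)
  then show ?thesis
    unfolding * by auto
qed

lemma charpoly_root_iff:
  "poly (charpoly M) t = 0 \<longleftrightarrow> (\<exists>x. x \<noteq> 0 \<and> M *v x = t *s x)"
  by (simp add: poly_charpoly det_shift_eq_0_iff)

text \<open>In the Leibniz expansion the identity contributes a product of N monic linear factors.
  Any other permutation moves some index, whose factor is then constant, so its term has degree
  below N.\<close>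

lemma degree_charpoly:
  fixes M :: "real^'n^'n"
  shows "degree (charpoly M) = CARD('n)"
proof -
  let ?X = "\<lambda>i j. (if i = j then [:0, 1:] else 0) - [:M $ i $ j:]"
  let ?P = "{p. p permutes (UNIV :: 'n set)}"
  let ?f = "\<lambda>p. of_int (sign p) * (\<Prod>i\<in>UNIV. ?X i (p i)) :: real poly"
  have eq: "charpoly M = ?f id + sum ?f (?P - {id})"
    unfolding charpoly_def det_def
    by (subst sum.remove[of _ id]) (auto simp: permutes_id)
  have diag: "?X i i = [:- (M $ i $ i), 1:]" for i
    by simp
  have id: "degree (?f id) = CARD('n)"
    unfolding id_apply diag by (simp add: degree_prod_eq_sum_degree)
  have "degree (?f p) < CARD('n)" if "p \<in> ?P - {id}" for p
  proof -
    have "p \<noteq> id"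
      using that by simp
    then obtain k where k: "p k \<noteq> k"
      by (metis eq_id_iff)
    have "degree (?f p) \<le> degree (\<Prod>i\<in>UNIV. ?X i (p i))"
      by (cases "evenperm p") (simp_all add: sign_def)
    also have "\<dots> \<le> (\<Sum>i\<in>UNIV. degree (?X i (p i)))"
      using degree_prod_sum_le[of UNIV "\<lambda>i. ?X i (p i)"] by simp
    also have "\<dots> < (\<Sum>i\<in>(UNIV :: 'n set). 1)"
      using k by (intro sum_strict_mono_ex1) (auto intro!: exI[of _ k])
    finally show ?thesis
      by simp
  qed
  then have "degree (sum ?f (?P - {id})) < CARD('n)"
    by (intro degree_sum_less) auto
  with eq id show ?thesis
    by (simp add: degree_add_eq_left)
qed

text \<open>Induction on the degree: the fundamental theorem of algebra gives a complex root, which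
  is real by hypothesis, and the cofactor of the corresponding linear factor is again
  real-rooted.\<close>

lemma size_proots_real_rooted:
  fixes p :: "real poly"
  assumes "p \<noteq> 0" "\<And>z. cpoly p z = 0 \<Longrightarrow> z \<in> \<real>"
  shows "size (proots p) = degree p"
  using assms
proof (induction "degree p" arbitrary: p)
  case 0
  then show ?case
    using size_proots_le[of p] by simp
next
  case (Suc n)
  have "\<not> constant (poly (map_poly complex_of_real p))"
    using Suc.hyps(2) by (simp add: constant_degree degree_map_poly)
  then obtain z where z: "cpoly p z = 0"
    unfolding cpoly_def using fundamental_theorem_of_algebra by blast
  then obtain r where r: "z = of_real r"
    using Suc.prems(2) by (auto elim: Reals_cases)
  have "cpoly p (of_real r) = of_real (poly p r)"
    by (simp add: cpoly_def poly_altdef degree_map_poly coeff_map_poly)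
  then have "poly p r = 0"
    using z r by simp
  then obtain q where q: "p = [:- r, 1:] * q"
    by (auto simp: poly_eq_0_iff_dvd)
  have q0: "q \<noteq> 0"
    using q Suc.prems by auto
  then have deg: "degree p = Suc (degree q)"
    by (subst q, subst degree_mult_eq) auto
  have "z \<in> \<real>" if "cpoly q z = 0" for z
    using that Suc.prems(2)[of z] unfolding q cpoly_def map_poly_of_real_mult by simp
  then have "size (proots q) = degree q"
    using Suc.hyps deg q0 by auto
  then show ?case
    unfolding deg by (subst q, subst proots_mult) (use q0 in auto)
qed

text \<open>With N roots counted with multiplicity, index \<open>CARD('n) - 1\<close> is valid and
  is the last position of the sorted list; with fewer roots it would be out of range.\<close>

lemma eigval_max:
  fixes M :: "real^'n^'n"
  assumes "size (proots (charpoly M)) = CARD('n)"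
  shows "poly (charpoly M) (eigval CARD('n) M) = 0"
    and "poly (charpoly M) t = 0 \<Longrightarrow> t \<le> eigval CARD('n) M"
proof -
  let ?xs = "sorted_list_of_multiset (proots (charpoly M))"
  have nz: "charpoly M \<noteq> 0"
    using assms by auto
  have len: "length ?xs = CARD('n)"
    using assms by (metis mset_sorted_list_of_multiset size_mset)
  have set: "set ?xs = {t. poly (charpoly M) t = 0}"
    using nz by simp
  have "eigval CARD('n) M \<in> set ?xs"
    unfolding eigval_def by (rule nth_mem) (simp add: len)
  then show "poly (charpoly M) (eigval CARD('n) M) = 0"
    unfolding set by simp
  assume "poly (charpoly M) t = 0"
  then have "t \<in> set ?xs"
    unfolding set by simp
  then obtain i where "i < CARD('n)" "t = ?xs ! i"
    unfolding in_set_conv_nth len by blast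
  then show "t \<le> eigval CARD('n) M"
    unfolding eigval_def
    by (auto intro!: sorted_nth_mono simp: len)
qed

subsection \<open>Matrices self-adjoint for a weighted inner product\<close>

text \<open>The equation says that \<open>diag(d) M\<close> is symmetric, that is, \<open>M\<close>
  is self-adjoint for the inner product with weights \<open>d\<close>.\<close>

definition symmetrizes :: "('n \<Rightarrow> real) \<Rightarrow> real^'n^'n \<Rightarrow> bool" where
  "symmetrizes d M \<longleftrightarrow> (\<forall>u. 0 < d u) \<and> (\<forall>u v. d u * M $ u $ v = d v * M $ v $ u)"

text \<open>For a complex eigenvector \<open>x\<close>, the weighted form \<open>q\<close> of
  \<open>x\<close> with \<open>M x\<close> equals its own conjugate and also equals
  \<open>z * n\<close> with \<open>n > 0\<close>.\<close>

lemma symmetrizable_complex_root_real: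
  fixes M :: "real^'n^'n"
  assumes "symmetrizes d M" "cpoly (charpoly M) z = 0"
  shows "z \<in> \<real>"
proof -
  from assms have d: "\<And>u. d u > 0" and sym: "\<And>u v. d u * M $ u $ v = d v * M $ v $ u"
    by (auto simp: symmetrizes_def)
  let ?M = "(\<chi> i j. complex_of_real (M $ i $ j)) :: complex^'n^'n"
  obtain x where x: "x \<noteq> 0" "?M *v x = z *s x"
    using assms(2) det_shift_eq_0_iff[of z ?M] unfolding cpoly_charpoly by auto
  define n where "n = (\<Sum>u\<in>UNIV. d u * (cmod (x $ u))\<^sup>2)"
  define q where "q = (\<Sum>u\<in>UNIV. \<Sum>v\<in>UNIV. of_real (d u * M $ u $ v) * cnj (x $ u) * x $ v)"
  obtain k where "x $ k \<noteq> 0"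
    using x(1) by (auto simp: vec_eq_iff)
  then have "n > 0"
    unfolding n_def using d by (intro sum_pos2[of _ k]) (auto simp: less_imp_le)
  have "cnj q = (\<Sum>u\<in>UNIV. \<Sum>v\<in>UNIV. of_real (d v * M $ v $ u) * x $ u * cnj (x $ v))"
    unfolding q_def by (simp add: sym)
  also have "\<dots> = q"
    unfolding q_def by (subst sum.swap) (simp add: mult_ac)
  finally have q: "q \<in> \<real>"
    by (simp add: Reals_cnj_iff)
  have x_eq: "(\<Sum>v\<in>UNIV. of_real (M $ u $ v) * x $ v) = z * x $ u" for u
    using arg_cong[OF x(2), of "\<lambda>y. y $ u"] by (simp add: matrix_vector_mult_def)
  have "q = (\<Sum>u\<in>UNIV. of_real (d u) * cnj (x $ u) * (z * x $ u))"
    unfolding q_def by (simp add: sum_distrib_left mult_ac flip: x_eq)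
  also have "\<dots> = z * of_real n"
    by (simp add: n_def sum_distrib_left complex_norm_square mult_ac del: of_real_power)
  finally have "z = q / of_real n"
    using \<open>n > 0\<close> by simp
  with q show ?thesis
    by simp
qed

lemma symmetrizable_eigval:
  fixes M :: "real^'n^'n"
  assumes "symmetrizes d M"
  shows "\<exists>x. x \<noteq> 0 \<and> M *v x = eigval CARD('n) M *s x"
    and "x \<noteq> 0 \<Longrightarrow> M *v x = t *s x \<Longrightarrow> t \<le> eigval CARD('n) M"
proof -
  have "charpoly M \<noteq> 0"
    using degree_charpoly[of M] by auto
  then have "size (proots (charpoly M)) = CARD('n)"
    using size_proots_real_rooted symmetrizable_complex_root_real[OF assms] degree_charpoly
    by metis
  note * = eigval_max[OF this]
  show "\<exists>x. x \<noteq> 0 \<and> M *v x = eigval CARD('n) M *s x"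
    using *(1) by (simp add: charpoly_root_iff)
  show "x \<noteq> 0 \<Longrightarrow> M *v x = t *s x \<Longrightarrow> t \<le> eigval CARD('n) M"
    using *(2) charpoly_root_iff by blast
qed

text \<open>First-order condition for a minimum at \<open>t = 0\<close>.\<close>

lemma linear_term_eq_0:
  fixes a b :: real
  assumes "\<And>t. 0 \<le> t * a + t\<^sup>2 * b"
  shows "a = 0"
proof (rule ccontr)
  assume "a \<noteq> 0"
  \<comment> \<open>Any positive \<open>c > b\<close> would do: at \<open>t = - a / c\<close> the
    expression is a positive multiple of \<open>b - c\<close>.\<close>
  define c where "c = \<bar>b\<bar> + 1"
  have c: "c > 0" "b < c"
    by (auto simp: c_def)
  have "0 \<le> (- a / c) * a + (- a / c)\<^sup>2 * b"
    by (rule assms)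
  also have "\<dots> = (a\<^sup>2 / c\<^sup>2) * (b - c)"
    using c by (simp add: field_simps power2_eq_square)
  also have "\<dots> < 0"
    using c \<open>a \<noteq> 0\<close> by (intro mult_pos_neg) auto
  finally show False
    by simp
qed

text \<open>By compactness the Rayleigh quotient \<open>B x x / I x x\<close> attains its maximum
  \<open>r\<close> on the Euclidean unit sphere, and by homogeneity \<open>r\<close> bounds it
  everywhere. A maximiser is an eigenvector, so \<open>r\<close> is at most the top
  eigenvalue.\<close>

lemma rayleigh_le_eigval:
  fixes M :: "real^'n^'n"
  assumes M: "symmetrizes d M"
  shows "(\<Sum>u\<in>UNIV. d u * x $ u * (M *v x) $ u)
           \<le> eigval CARD('n) M * (\<Sum>u\<in>UNIV. d u * (x $ u)\<^sup>2)"
proof -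
  from M have d: "\<And>u. d u > 0" and sym: "\<And>u v. d u * M $ u $ v = d v * M $ v $ u"
    by (auto simp: symmetrizes_def)
  define B where "B x y = (\<Sum>u\<in>UNIV. d u * x $ u * (M *v y) $ u)" for x y :: "real^'n"
  define I where "I x y = (\<Sum>u\<in>UNIV. d u * x $ u * y $ u)" for x y :: "real^'n"
  have B_eq: "B x y = (\<Sum>u\<in>UNIV. \<Sum>v\<in>UNIV. (d u * M $ u $ v) * x $ u * y $ v)" for x y
    by (simp add: B_def matrix_vector_mult_def sum_distrib_left mult_ac)
  have B_sym: "B x y = B y x" for x y
  proof -
    have "B x y = (\<Sum>u\<in>UNIV. \<Sum>v\<in>UNIV. (d v * M $ v $ u) * x $ u * y $ v)"
      unfolding B_eq by (simp add: sym)
    also have "\<dots> = B y x"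
      unfolding B_eq by (subst sum.swap) (simp add: mult_ac)
    finally show ?thesis .
  qed
  have I_sym: "I x y = I y x" for x y
    by (simp add: I_def mult_ac)
  have B_lin: "B x (y + t *\<^sub>R z) = B x y + t * B x z" for x y z t
    by (simp add: B_eq sum.distrib sum_distrib_left algebra_simps)
  have I_lin: "I x (y + t *\<^sub>R z) = I x y + t * I x z" for x y z t
    by (simp add: I_def sum.distrib sum_distrib_left algebra_simps)
  have B_quad: "B (y + t *\<^sub>R z) (y + t *\<^sub>R z) = B y y + 2 * t * B z y + t\<^sup>2 * B z z" for y z t
  proof -
    have "B (y + t *\<^sub>R z) (y + t *\<^sub>R z) = B (y + t *\<^sub>R z) y + t * B (y + t *\<^sub>R z) z"
      by (rule B_lin)
    also have "\<dots> = B y (y + t *\<^sub>R z) + t * B z (y + t *\<^sub>R z)"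
      by (simp only: B_sym)
    also have "\<dots> = B y y + 2 * t * B z y + t\<^sup>2 * B z z"
      unfolding B_lin B_sym[of y z] by (simp add: algebra_simps power2_eq_square)
    finally show ?thesis .
  qed
  have I_quad: "I (y + t *\<^sub>R z) (y + t *\<^sub>R z) = I y y + 2 * t * I z y + t\<^sup>2 * I z z" for y z t
  proof -
    have "I (y + t *\<^sub>R z) (y + t *\<^sub>R z) = I (y + t *\<^sub>R z) y + t * I (y + t *\<^sub>R z) z"
      by (rule I_lin)
    also have "\<dots> = I y (y + t *\<^sub>R z) + t * I z (y + t *\<^sub>R z)"
      by (simp only: I_sym)
    also have "\<dots> = I y y + 2 * t * I z y + t\<^sup>2 * I z z"
      unfolding I_lin I_sym[of y z] by (simp add: algebra_simps power2_eq_square)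
    finally show ?thesis .
  qed
  have I_pos: "I x x > 0" if nonzero: "x \<noteq> 0" for x
  proof -
    obtain k where "x $ k \<noteq> 0"
      using nonzero by (auto simp: vec_eq_iff)
    moreover have "I x x = (\<Sum>u\<in>UNIV. d u * (x $ u)\<^sup>2)"
      by (simp add: I_def power2_eq_square mult.assoc)
    ultimately show ?thesis
      using d by (auto intro!: sum_pos2[of _ k] simp: less_imp_le)
  qed
  let ?S = "sphere (0 :: real^'n) 1"
  have "\<exists>x\<in>?S. \<forall>y\<in>?S. B y y / I y y \<le> B x x / I x x"
  proof (rule continuous_attains_sup)
    show "?S \<noteq> {}"
      by (simp)
    show "continuous_on ?S (\<lambda>x. B x x / I x x)"
      unfolding B_eq I_def
      by (intro continuous_intros ballI) (metis I_def I_pos less_irrefl norm_zero zero_neq_one mem_sphere_0)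
  qed simp
  then obtain x\<^sub>0 where x0: "norm x\<^sub>0 = 1" and max: "\<And>y. norm y = 1 \<Longrightarrow> B y y / I y y \<le> B x\<^sub>0 x\<^sub>0 / I x\<^sub>0 x\<^sub>0"
    by auto
  define r where "r = B x\<^sub>0 x\<^sub>0 / I x\<^sub>0 x\<^sub>0"
  have nz: "x\<^sub>0 \<noteq> 0"
    using x0 by auto
  have B0: "B x\<^sub>0 x\<^sub>0 = r * I x\<^sub>0 x\<^sub>0"
    using I_pos[OF nz] by (simp add: r_def)
  have B_le: "B y y \<le> r * I y y" for y
  proof (cases "y = 0")
    case True
    then show ?thesis
      by (simp add: B_eq I_def)
  next
    case False
    let ?c = "inverse (norm y)"
    have "B (?c *\<^sub>R y) (?c *\<^sub>R y) / I (?c *\<^sub>R y) (?c *\<^sub>R y) \<le> r"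
      unfolding r_def using False by (intro max) simp
    \<comment> \<open>Homogeneity of degree 2 is the quadratic expansion around the zero
      vector.\<close>
    moreover have "B (?c *\<^sub>R y) (?c *\<^sub>R y) = ?c\<^sup>2 * B y y" "I (?c *\<^sub>R y) (?c *\<^sub>R y) = ?c\<^sup>2 * I y y"
      using B_quad[of 0 ?c y] I_quad[of 0 ?c y] by (simp_all add: B_eq I_def)
    ultimately show ?thesis
      using False I_pos[OF False] by (simp add: divide_le_eq mult_ac)
  qed
  \<comment> \<open>\<open>r * I - B\<close> is nonnegative and vanishes at \<open>x\<^sub>0\<close>, so its derivative at \<open>x\<^sub>0\<close> is zero.\<close>
  have crit: "B z x\<^sub>0 = r * I z x\<^sub>0" for z
  proof -
    have "r * I z x\<^sub>0 - B z x\<^sub>0 = 0"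
    proof (rule linear_term_eq_0)
      fix t :: real
      \<comment> \<open>The step \<open>t/2\<close> absorbs the factor 2 of the cross term, leaving
        \<open>t\<close> times the derivative term.\<close>
      have "0 \<le> r * I (x\<^sub>0 + (t/2) *\<^sub>R z) (x\<^sub>0 + (t/2) *\<^sub>R z) - B (x\<^sub>0 + (t/2) *\<^sub>R z) (x\<^sub>0 + (t/2) *\<^sub>R z)"
        using B_le by simp
      then show "0 \<le> t * (r * I z x\<^sub>0 - B z x\<^sub>0) + t\<^sup>2 * ((r * I z z - B z z) / 4)"
        unfolding B_quad I_quad B0 by (simp add: field_simps power2_eq_square)
    qed
    then show ?thesis
      by simp
  qed
  have "M *v x\<^sub>0 = r *s x\<^sub>0"
  proof -
    \<comment> \<open>Pairing with a coordinate vector isolates one coordinate, multiplied by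
      \<open>d u > 0\<close>, which cancels.\<close>
    have "(M *v x\<^sub>0) $ u = r * x\<^sub>0 $ u" for u
      using crit[of "axis u 1"] d[of u]
      by (simp add: B_def I_def axis_def if_distrib[of "\<lambda>a. a * _"] if_distrib[of "\<lambda>a. _ * a"]
          cong: if_cong)
    then show ?thesis
      by (simp add: vec_eq_iff)
  qed
  then have "r \<le> eigval CARD('n) M"
    by (rule symmetrizable_eigval(2)[OF M nz])
  moreover have "0 \<le> I x x"
    using I_pos[of x] by (cases "x = 0") (auto simp: I_def)
  ultimately have "B x x \<le> eigval CARD('n) M * I x x"
    using B_le[of x] mult_right_mono by (meson order_trans)
  then show ?thesis
    by (simp add: B_def I_def power2_eq_square mult.assoc)
qed

subsection \<open>Level sets\<close>

lemma sum_symmetrize: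
  fixes g :: "'a \<Rightarrow> 'a \<Rightarrow> 'b::comm_semiring_1"
  shows "2 * (\<Sum>u\<in>A. \<Sum>v\<in>A. g u v) = (\<Sum>u\<in>A. \<Sum>v\<in>A. g u v + g v u)"
  unfolding mult_2 sum.distrib by (rule arg_cong[OF sum.swap])

lemma sum_sum_filter:
  fixes g :: "'a::finite \<Rightarrow> 'b::finite \<Rightarrow> real"
  shows "(\<Sum>u\<in>A. \<Sum>v\<in>{v\<in>B. P u v}. g u v)
           = (\<Sum>u\<in>UNIV. \<Sum>v\<in>UNIV. if u \<in> A \<and> v \<in> B \<and> P u v then g u v else 0)"
proof -
  have "(\<Sum>v\<in>{v\<in>B. P u v}. g u v) = (\<Sum>v\<in>UNIV. if v \<in> B \<and> P u v then g u v else 0)" for u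
    by (simp add: sum.If_cases)
  then have "(\<Sum>u\<in>A. \<Sum>v\<in>{v\<in>B. P u v}. g u v)
      = (\<Sum>u\<in>UNIV. if u \<in> A then (\<Sum>v\<in>UNIV. if v \<in> B \<and> P u v then g u v else 0) else 0)"
    by (simp add: sum.If_cases)
  also have "\<dots> = (\<Sum>u\<in>UNIV. \<Sum>v\<in>UNIV. if u \<in> A \<and> v \<in> B \<and> P u v then g u v else 0)"
    by (intro sum.cong) auto
  finally show ?thesis .
qed

text \<open>Applied to all coordinates of a vector, this is the 1, -1, 0 test vector of its pair of
  level sets at \<open>t\<close>. The threshold is on the square so that integrating the indicator
  over \<open>t\<close> yields the square.\<close>

definition level_sign :: "real \<Rightarrow> real \<Rightarrow> real" where
  "level_sign t a = (if t < a\<^sup>2 then sgn a else 0)"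

lemma has_integral_level:
  fixes y :: real
  assumes "0 \<le> y" "y \<le> T"
  shows "((\<lambda>t. if t < y then 1 else 0) has_integral y) {0..T}"
proof -
  have "((\<lambda>t. 1) has_integral y) {0..y}"
    using has_integral_const_real[of "1::real" 0 y] assms by simp
  then have "((\<lambda>t. if t \<in> {0..y} then 1 else 0) has_integral y) {0..T}"
    using assms by (subst has_integral_restrict) auto
  \<comment> \<open>The strict and the closed indicator differ only at \<open>t = y\<close>.\<close>
  then show ?thesis
    by (rule has_integral_spike[of "{y}", rotated 2]) auto
qed

text \<open>Without opposite signs the two indicators add up, giving the sum of the squares. With
  opposite signs they cancel below the smaller square, leaving the difference of the squares, which
  is \<open>\<bar>a + b\<bar> * \<bar>a - b\<bar>\<close> in absolute value.\<close>

lemma has_integral_level_sign: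
  assumes "a\<^sup>2 \<le> T" "b\<^sup>2 \<le> T"
  shows "\<exists>G\<le>\<bar>a + b\<bar> * (\<bar>a\<bar> + \<bar>b\<bar>).
           ((\<lambda>t. \<bar>level_sign t a + level_sign t b\<bar>) has_integral G) {0..T}"
proof -
  let ?\<theta> = "\<lambda>y t. if t < y then 1 else 0 :: real"
  have int: "(?\<theta> (a\<^sup>2) has_integral a\<^sup>2) {0..T}" "(?\<theta> (b\<^sup>2) has_integral b\<^sup>2) {0..T}"
    using assms by (auto intro!: has_integral_level)
  consider (same) "0 \<le> a \<and> 0 \<le> b \<or> a \<le> 0 \<and> b \<le> 0"
    | (gt) "a < 0 \<and> 0 < b \<or> 0 < a \<and> b < 0" "a\<^sup>2 \<le> b\<^sup>2"
    | (lt) "a < 0 \<and> 0 < b \<or> 0 < a \<and> b < 0" "b\<^sup>2 \<le> a\<^sup>2"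
    by linarith
  then show ?thesis
  proof cases
    case same
    have "((\<lambda>t. ?\<theta> (a\<^sup>2) t + ?\<theta> (b\<^sup>2) t) has_integral a\<^sup>2 + b\<^sup>2) {0..T}"
      by (intro has_integral_add int)
    then have "((\<lambda>t. \<bar>level_sign t a + level_sign t b\<bar>) has_integral a\<^sup>2 + b\<^sup>2) {0..T}"
      by (rule has_integral_eq[rotated])
        (use same in \<open>auto simp: level_sign_def sgn_if\<close>)
    moreover have "\<bar>a + b\<bar> = \<bar>a\<bar> + \<bar>b\<bar>"
      using same by auto
    then have "\<bar>a + b\<bar> * (\<bar>a\<bar> + \<bar>b\<bar>) = a\<^sup>2 + b\<^sup>2 + 2 * \<bar>a * b\<bar>"
      by (simp add: algebra_simps power2_eq_square abs_mult)
    then have "a\<^sup>2 + b\<^sup>2 \<le> \<bar>a + b\<bar> * (\<bar>a\<bar> + \<bar>b\<bar>)"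
      by simp
    ultimately show ?thesis
      by blast
  next
    case gt
    have "((\<lambda>t. ?\<theta> (b\<^sup>2) t - ?\<theta> (a\<^sup>2) t) has_integral b\<^sup>2 - a\<^sup>2) {0..T}"
      by (intro has_integral_diff int)
    then have "((\<lambda>t. \<bar>level_sign t a + level_sign t b\<bar>) has_integral b\<^sup>2 - a\<^sup>2) {0..T}"
      by (rule has_integral_eq[rotated])
        (use gt in \<open>auto simp: level_sign_def sgn_if\<close>)
    moreover have "b\<^sup>2 - a\<^sup>2 = \<bar>a + b\<bar> * \<bar>b - a\<bar>"
      using gt(2) by (simp add: power2_eq_square algebra_simps flip: abs_mult)
    then have "b\<^sup>2 - a\<^sup>2 \<le> \<bar>a + b\<bar> * (\<bar>a\<bar> + \<bar>b\<bar>)"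
      by (simp add: mult_left_mono)
    ultimately show ?thesis
      by blast
  next
    case lt
    have "((\<lambda>t. ?\<theta> (a\<^sup>2) t - ?\<theta> (b\<^sup>2) t) has_integral a\<^sup>2 - b\<^sup>2) {0..T}"
      by (intro has_integral_diff int)
    then have "((\<lambda>t. \<bar>level_sign t a + level_sign t b\<bar>) has_integral a\<^sup>2 - b\<^sup>2) {0..T}"
      by (rule has_integral_eq[rotated])
        (use lt in \<open>auto simp: level_sign_def sgn_if\<close>)
    moreover have "a\<^sup>2 - b\<^sup>2 = \<bar>a + b\<bar> * \<bar>a - b\<bar>"
      using lt(2) by (simp add: power2_eq_square algebra_simps flip: abs_mult)
    then have "a\<^sup>2 - b\<^sup>2 \<le> \<bar>a + b\<bar> * (\<bar>a\<bar> + \<bar>b\<bar>)"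
      by (simp add: mult_left_mono)
    ultimately show ?thesis
      by blast
  qed
qed

section \<open>Inverse of the degree matrix\<close>

lemma matrix_inv_degree_matrix:
  assumes "\<And>u. wdegree w u \<noteq> 0"
  shows "matrix_inv (degree_matrix w) = (\<chi> u v. if u = v then inverse (wdegree w u) else 0)"
    (is "_ = ?D'")
proof -
  let ?D = "degree_matrix w"
  have "?D ** ?D' = mat 1" "?D' ** ?D = mat 1"
    using assms
    by (simp_all add: vec_eq_iff degree_matrix_def matrix_matrix_mult_def mat_def
        if_distrib[of "\<lambda>a. a * _"] cong: if_cong)
  then have "invertible ?D"
    unfolding invertible_def by blast
  \<comment> \<open>\<open>matrix_inv\<close> is a choice among two-sided inverses, so existence
    gives this equation; associativity then identifies it with \<open>?D'\<close>.\<close>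
  then have "matrix_inv ?D ** ?D = mat 1"
    unfolding invertible_def matrix_inv_def by (rule someI2_ex) blast
  have "matrix_inv ?D = matrix_inv ?D ** (?D ** ?D')"
    using \<open>?D ** ?D' = mat 1\<close> by simp
  also have "\<dots> = ?D'"
    unfolding matrix_mul_assoc \<open>matrix_inv ?D ** ?D = mat 1\<close> by simp
  finally show ?thesis .
qed

subsection \<open>Signed graphs\<close>

context signed_graph
begin

text \<open>The value \<open>1\<close> off the edges is harmless since the weight vanishes there, and it keeps
  \<open>edge_sign u v\<close> of square \<open>1\<close> for all pairs.\<close>

definition edge_sign :: "'v \<Rightarrow> 'v \<Rightarrow> real" where
  "edge_sign u v = (if {u, v} \<in> E then of_int (\<sigma> {u, v}) else 1)"

text \<open>The quadratic form of \<open>D\<close> plus the signed adjacency matrix. The half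
  offsets the double count of each edge as two ordered pairs.\<close>

definition energy :: "('v \<Rightarrow> real) \<Rightarrow> real" where
  "energy x = (\<Sum>u\<in>UNIV. \<Sum>v\<in>UNIV. w u v * (x u + edge_sign u v * x v)\<^sup>2) / 2"

text \<open>The numerator of \<open>\<beta>\<close> for the negated signature.\<close>

definition frustration :: "'v set \<Rightarrow> 'v set \<Rightarrow> real" where
  "frustration V1 V2 =
     2 * edge_weight_sign E w (\<lambda>e. - \<sigma> e) 1 V1 V2
       + edge_weight_sign E w (\<lambda>e. - \<sigma> e) (-1) V1 V1
       + edge_weight_sign E w (\<lambda>e. - \<sigma> e) (-1) V2 V2
       + edge_weight w (V1 \<union> V2) (- (V1 \<union> V2))"

section \<open>The Laplacian and its energy form\<close>

lemma weight_nonneg: "0 \<le> w u v"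
  using weight_pos[of u v] weight_nonedge[of u v] by (cases "{u, v} \<in> E") auto

lemma edge_sign_cases: "edge_sign u v = 1 \<or> edge_sign u v = - 1"
  using sign_values[of "{u, v}"] by (auto simp: edge_sign_def)

lemma edge_sign_sym: "edge_sign u v = edge_sign v u"
  by (simp add: edge_sign_def insert_commute)

lemma edge_sign_power2: "(edge_sign u v)\<^sup>2 = 1"
  using edge_sign_cases[of u v] by auto

lemma signed_adjacency_eq: "signed_adjacency E w \<sigma> $ u $ v = edge_sign u v * w u v"
  by (simp add: signed_adjacency_def edge_sign_def weight_nonedge)

lemma degree_times_signed_laplacian:
  "wdegree w u * signed_laplacian E w \<sigma> $ u $ v
     = (if u = v then wdegree w u else 0) - edge_sign u v * w u v"
proof -
  have nz: "wdegree w u \<noteq> 0" for u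
    using degree_pos[of u] by simp
  have "(matrix_inv (degree_matrix w) ** signed_adjacency E w \<sigma>) $ u $ v
      = inverse (wdegree w u) * (edge_sign u v * w u v)"
    unfolding matrix_inv_degree_matrix[OF nz]
    by (simp add: matrix_matrix_mult_def signed_adjacency_eq if_distrib[of "\<lambda>a. a * _"] cong: if_cong)
  then show ?thesis
    using nz[of u] by (simp add: signed_laplacian_def mat_def right_diff_distrib flip: mult.assoc)
qed

lemma symmetrizes_signed_laplacian: "symmetrizes (wdegree w) (signed_laplacian E w \<sigma>)"
  unfolding symmetrizes_def degree_times_signed_laplacian
  using degree_pos by (auto simp: weight_sym edge_sign_sym)

lemma sum_weight_power2: "(\<Sum>u\<in>UNIV. \<Sum>v\<in>UNIV. w u v * (x u)\<^sup>2) = (\<Sum>u\<in>UNIV. wdegree w u * (x u)\<^sup>2)"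
  by (simp add: wdegree_def sum_distrib_right)

lemma sum_weight_power2': "(\<Sum>u\<in>UNIV. \<Sum>v\<in>UNIV. w u v * (x v)\<^sup>2) = (\<Sum>u\<in>UNIV. wdegree w u * (x u)\<^sup>2)"
proof -
  have "(\<Sum>u\<in>UNIV. \<Sum>v\<in>UNIV. w u v * (x v)\<^sup>2) = (\<Sum>v\<in>UNIV. \<Sum>u\<in>UNIV. w u v * (x v)\<^sup>2)"
    by (rule sum.swap)
  also have "\<dots> = (\<Sum>v\<in>UNIV. \<Sum>u\<in>UNIV. w v u * (x v)\<^sup>2)"
    by (intro sum.cong refl arg_cong2[where f = "(*)"] weight_sym)
  finally show ?thesis
    by (simp add: sum_weight_power2)
qed

text \<open>This is \<open>D (2 I - L) = D + A\<close> for the Laplacian \<open>L\<close> and signed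
  adjacency \<open>A\<close>, read as quadratic forms. It converts bounds on Rayleigh quotients into
  bounds on the energy.\<close>

lemma energy_eq:
  "energy (\<lambda>u. x $ u) = 2 * (\<Sum>u\<in>UNIV. wdegree w u * (x $ u)\<^sup>2)
     - (\<Sum>u\<in>UNIV. wdegree w u * x $ u * (signed_laplacian E w \<sigma> *v x) $ u)"
proof -
  let ?Q = "\<Sum>u\<in>UNIV. wdegree w u * (x $ u)\<^sup>2"
  let ?A = "\<Sum>u\<in>UNIV. \<Sum>v\<in>UNIV. edge_sign u v * w u v * x $ u * x $ v"
  have "wdegree w u * x $ u * (signed_laplacian E w \<sigma> *v x) $ u
      = wdegree w u * (x $ u)\<^sup>2 - (\<Sum>v\<in>UNIV. edge_sign u v * w u v * x $ u * x $ v)" for u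
  proof -
    have "wdegree w u * x $ u * (signed_laplacian E w \<sigma> *v x) $ u
        = (\<Sum>v\<in>UNIV. (wdegree w u * signed_laplacian E w \<sigma> $ u $ v) * x $ u * x $ v)"
      by (simp add: matrix_vector_mult_def sum_distrib_left mult_ac)
    also have "\<dots> = wdegree w u * (x $ u)\<^sup>2 - (\<Sum>v\<in>UNIV. edge_sign u v * w u v * x $ u * x $ v)"
      unfolding degree_times_signed_laplacian left_diff_distrib sum_subtractf
      by (simp add: if_distrib[of "\<lambda>a. a * _"] power2_eq_square mult.assoc cong: if_cong)
    finally show ?thesis .
  qed
  then have "(\<Sum>u\<in>UNIV. wdegree w u * x $ u * (signed_laplacian E w \<sigma> *v x) $ u) = ?Q - ?A"
    by (simp add: sum_subtractf)
  moreover have "w u v * (x $ u + edge_sign u v * x $ v)\<^sup>2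
      = w u v * (x $ u)\<^sup>2 + w u v * (x $ v)\<^sup>2 + 2 * (edge_sign u v * w u v * x $ u * x $ v)" for u v
    by (simp add: power2_sum power_mult_distrib edge_sign_power2 algebra_simps)
  then have "2 * energy (\<lambda>u. x $ u) = ?Q + ?Q + 2 * ?A"
    by (simp add: energy_def sum.distrib sum_weight_power2 sum_weight_power2' flip: sum_distrib_left)
  ultimately show ?thesis
    by simp
qed

section \<open>Frustration of a pair of disjoint sets\<close>

text \<open>Per ordered pair, the absolute value is 2 for a positive edge inside \<open>V1\<close>
  or inside \<open>V2\<close> and for a negative edge between them, 1 for a boundary edge, and 0 for
  all other edges. Negating the signature makes \<open>frustration\<close> count the same
  edges.\<close>

lemma frustration_eq:
  assumes "V1 \<inter> V2 = {}"
    and z: "\<And>u. z u = (if u \<in> V1 then 1 else if u \<in> V2 then - 1 else 0)"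
  shows "frustration V1 V2 = (\<Sum>u\<in>UNIV. \<Sum>v\<in>UNIV. w u v * \<bar>z u + edge_sign u v * z v\<bar>) / 2"
proof -
  define g where "g s A B u v = (if u \<in> A \<and> v \<in> B \<and> edge_sign u v = s then w u v else 0)"
    for s A B u v
  define c where "c u v = (if u \<in> V1 \<union> V2 \<and> v \<in> - (V1 \<union> V2) then w u v else 0)" for u v
  let ?S = "\<lambda>f. \<Sum>u\<in>UNIV. \<Sum>v\<in>UNIV. f u v :: real"
  \<comment> \<open>The sign is flipped because the signature is negated. Non-edges that pass the
    filter in \<open>g\<close> have weight 0.\<close>
  have g: "edge_weight_sign E w (\<lambda>e. - \<sigma> e) k A B = ?S (g (- of_int k) A B)" for k A B
    unfolding edge_weight_sign_def sum_sum_filter g_def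
    by (intro sum.cong) (auto simp: edge_sign_def weight_nonedge)
  have c: "edge_weight w (V1 \<union> V2) (- (V1 \<union> V2)) = ?S c"
    using sum_sum_filter[where P = "\<lambda>_ _. True" and g = w] by (simp add: edge_weight_def c_def)
  have "2 * frustration V1 V2 = 2 * (2 * ?S (g (- 1) V1 V2)) + 2 * ?S (g 1 V1 V1)
      + 2 * ?S (g 1 V2 V2) + 2 * ?S c"
    unfolding frustration_def g c by simp
  \<comment> \<open>\<open>frustration\<close> takes cross and boundary edges in one orientation
    only, so these terms are symmetrised before comparing summands.\<close>
  also have "\<dots> = ?S (\<lambda>u v. 2 * (g (- 1) V1 V2 u v + g (- 1) V1 V2 v u) + 2 * g 1 V1 V1 u v
      + 2 * g 1 V2 V2 u v + (c u v + c v u))"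
    unfolding sum_symmetrize[where g = c] sum_symmetrize[where g = "g (- 1) V1 V2"]
    by (simp add: sum.distrib sum_distrib_left)
  also have "\<dots> = ?S (\<lambda>u v. w u v * \<bar>z u + edge_sign u v * z v\<bar>)"
  proof (intro sum.cong refl)
    fix u v
    show "2 * (g (- 1) V1 V2 u v + g (- 1) V1 V2 v u) + 2 * g 1 V1 V1 u v
        + 2 * g 1 V2 V2 u v + (c u v + c v u) = w u v * \<bar>z u + edge_sign u v * z v\<bar>"
    proof -
      have "\<not> (u \<in> V1 \<and> u \<in> V2)" "\<not> (v \<in> V1 \<and> v \<in> V2)"
        using assms(1) by auto
      with edge_sign_cases[of u v] show ?thesis
        unfolding g_def c_def z weight_sym[of v u] edge_sign_sym[of v u]
        by (elim disjE; cases "u \<in> V1"; cases "u \<in> V2"; cases "v \<in> V1"; cases "v \<in> V2") simp_all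
    qed
  qed
  finally show ?thesis
    by simp
qed

text \<open>The absolute values take only the values 0, 1 and 2, where the square is at most twice
  the value.\<close>

lemma energy_le_frustration:
  assumes "V1 \<inter> V2 = {}"
    and z: "\<And>u. z u = (if u \<in> V1 then 1 else if u \<in> V2 then - 1 else 0)"
  shows "energy z \<le> 2 * frustration V1 V2"
proof -
  have "(z u + edge_sign u v * z v)\<^sup>2 \<le> 2 * \<bar>z u + edge_sign u v * z v\<bar>" for u v
    using edge_sign_cases[of u v] by (auto simp: z)
  then have "w u v * (z u + edge_sign u v * z v)\<^sup>2 \<le> w u v * (2 * \<bar>z u + edge_sign u v * z v\<bar>)" for u v
    by (rule mult_left_mono) (rule weight_nonneg)
  then have "(\<Sum>u\<in>UNIV. \<Sum>v\<in>UNIV. w u v * (z u + edge_sign u v * z v)\<^sup>2)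
      \<le> (\<Sum>u\<in>UNIV. \<Sum>v\<in>UNIV. w u v * (2 * \<bar>z u + edge_sign u v * z v\<bar>))"
    by (intro sum_mono)
  also have "\<dots> = 2 * (2 * frustration V1 V2)"
    unfolding frustration_eq[OF assms] by (simp add: sum_distrib_left mult_ac)
  finally show ?thesis
    by (simp add: energy_def)
qed

section \<open>Averaging over level sets and Cauchy-Schwarz\<close>

text \<open>Integrate the hypothesis for the level sets over \<open>t\<close> from 0 to
  \<open>T\<close>: volumes integrate to the weighted sum of squares, and
  \<open>has_integral_level_sign\<close> bounds the integrated frustration edge by edge.\<close>

lemma sum_level_bound:
  assumes h: "\<And>V1 V2. V1 \<inter> V2 = {} \<Longrightarrow> V1 \<union> V2 \<noteq> {} \<Longrightarrow> h * vol (wdegree w) (V1 \<union> V2) \<le> frustration V1 V2"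
  shows "h * (\<Sum>u\<in>UNIV. wdegree w u * (x u)\<^sup>2)
    \<le> (\<Sum>u\<in>UNIV. \<Sum>v\<in>UNIV. w u v * (\<bar>x u + edge_sign u v * x v\<bar> * (\<bar>x u\<bar> + \<bar>x v\<bar>))) / 2"
proof -
  define T where "T = (\<Sum>u\<in>UNIV. (x u)\<^sup>2)"
  have T: "(x u)\<^sup>2 \<le> T" for u
    unfolding T_def by (rule member_le_sum) auto
  have "\<exists>G\<le>\<bar>x u + edge_sign u v * x v\<bar> * (\<bar>x u\<bar> + \<bar>edge_sign u v * x v\<bar>).
      ((\<lambda>t. \<bar>level_sign t (x u) + level_sign t (edge_sign u v * x v)\<bar>) has_integral G) {0..T}" for u v
    using T by (intro has_integral_level_sign) (auto simp: power_mult_distrib edge_sign_power2)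
  \<comment> \<open>\<open>level_sign\<close> is odd in its second argument, so a factor 1 or -1 can
    be pulled out.\<close>
  moreover have "level_sign t (edge_sign u v * x v) = edge_sign u v * level_sign t (x v)"
    "\<bar>edge_sign u v * x v\<bar> = \<bar>x v\<bar>" for t u v
    using edge_sign_cases[of u v] by (auto simp: level_sign_def sgn_minus)
  ultimately have ex: "\<exists>G\<le>\<bar>x u + edge_sign u v * x v\<bar> * (\<bar>x u\<bar> + \<bar>x v\<bar>).
      ((\<lambda>t. \<bar>level_sign t (x u) + edge_sign u v * level_sign t (x v)\<bar>) has_integral G) {0..T}" for u v
    by simp
  define G where "G u v = integral {0..T} (\<lambda>t. \<bar>level_sign t (x u) + edge_sign u v * level_sign t (x v)\<bar>)" for u v
  have G: "G u v \<le> \<bar>x u + edge_sign u v * x v\<bar> * (\<bar>x u\<bar> + \<bar>x v\<bar>)"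
    "((\<lambda>t. \<bar>level_sign t (x u) + edge_sign u v * level_sign t (x v)\<bar>) has_integral G u v) {0..T}" for u v
    using ex[of u v] unfolding G_def by (auto simp: integral_unique)
  have vol: "((\<lambda>t. \<Sum>u\<in>UNIV. wdegree w u * (if t < (x u)\<^sup>2 then 1 else 0))
      has_integral (\<Sum>u\<in>UNIV. wdegree w u * (x u)\<^sup>2)) {0..T}"
    using T by (intro has_integral_sum has_integral_mult_right has_integral_level) auto
  have num: "((\<lambda>t. (\<Sum>u\<in>UNIV. \<Sum>v\<in>UNIV. w u v * \<bar>level_sign t (x u) + edge_sign u v * level_sign t (x v)\<bar>) / 2)
      has_integral (\<Sum>u\<in>UNIV. \<Sum>v\<in>UNIV. w u v * G u v) / 2) {0..T}"
    by (intro has_integral_divide has_integral_sum has_integral_mult_right G) auto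
  have "h * (\<Sum>u\<in>UNIV. wdegree w u * (x u)\<^sup>2) \<le> (\<Sum>u\<in>UNIV. \<Sum>v\<in>UNIV. w u v * G u v) / 2"
  proof (rule has_integral_le[OF has_integral_mult_right[OF vol] num])
    fix t assume "t \<in> {0..T}"
    then have t: "\<not> t < 0"
      by simp
    define V1 where "V1 = {u. 0 < x u \<and> t < (x u)\<^sup>2}"
    define V2 where "V2 = {u. x u < 0 \<and> t < (x u)\<^sup>2}"
    \<comment> \<open>Since \<open>t\<close> is nonnegative, a vertex with \<open>x u = 0\<close>
      never exceeds the threshold.\<close>
    have union: "V1 \<union> V2 = {u. t < (x u)\<^sup>2}"
    proof -
      have "x u \<noteq> 0" if "t < (x u)\<^sup>2" for u
        using that t by auto
      then show ?thesis
        unfolding V1_def V2_def by (auto simp: neq_iff)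
    qed
    have disj: "V1 \<inter> V2 = {}"
      by (auto simp: V1_def V2_def)
    have frus: "frustration V1 V2 =
        (\<Sum>u\<in>UNIV. \<Sum>v\<in>UNIV. w u v * \<bar>level_sign t (x u) + edge_sign u v * level_sign t (x v)\<bar>) / 2"
      by (rule frustration_eq[OF disj]) (auto simp: level_sign_def V1_def V2_def sgn_if)
    have "h * vol (wdegree w) (V1 \<union> V2) \<le> frustration V1 V2"
    proof (cases "V1 \<union> V2 = {}")
      \<comment> \<open>For large \<open>t\<close> both level sets are empty and \<open>h\<close>
        gives nothing; the volume is then 0.\<close>
      case True
      have "0 \<le> frustration V1 V2"
        unfolding frus by (simp add: sum_nonneg weight_nonneg)
      then show ?thesis
        unfolding True by (simp add: vol_def)
    qed (intro h disj)
    moreover have "vol (wdegree w) (V1 \<union> V2) = (\<Sum>u\<in>UNIV. wdegree w u * (if t < (x u)\<^sup>2 then 1 else 0))"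
      unfolding vol_def union by (simp add: if_distrib[of "\<lambda>a. _ * a"] sum.If_cases cong: if_cong)
    ultimately show "h * (\<Sum>u\<in>UNIV. wdegree w u * (if t < (x u)\<^sup>2 then 1 else 0))
        \<le> (\<Sum>u\<in>UNIV. \<Sum>v\<in>UNIV. w u v * \<bar>level_sign t (x u) + edge_sign u v * level_sign t (x v)\<bar>) / 2"
      unfolding frus by simp
  qed
  also have "\<dots> \<le> (\<Sum>u\<in>UNIV. \<Sum>v\<in>UNIV. w u v * (\<bar>x u + edge_sign u v * x v\<bar> * (\<bar>x u\<bar> + \<bar>x v\<bar>))) / 2"
    by (intro divide_right_mono sum_mono mult_left_mono G weight_nonneg) auto
  finally show ?thesis .
qed

text \<open>Each weight is split into two square roots. The first factor sums to
  \<open>2 * energy x\<close> and the second to at most 4 times the weighted sum of squares, whence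
  the 8.\<close>

lemma sum_level_Cauchy_Schwarz:
  "(\<Sum>u\<in>UNIV. \<Sum>v\<in>UNIV. w u v * (\<bar>x u + edge_sign u v * x v\<bar> * (\<bar>x u\<bar> + \<bar>x v\<bar>)))\<^sup>2
     \<le> 8 * energy x * (\<Sum>u\<in>UNIV. wdegree w u * (x u)\<^sup>2)"
proof -
  let ?a = "\<lambda>(u, v). sqrt (w u v) * \<bar>x u + edge_sign u v * x v\<bar>"
  let ?b = "\<lambda>(u, v). sqrt (w u v) * (\<bar>x u\<bar> + \<bar>x v\<bar>)"
  have "(\<Sum>u\<in>UNIV. \<Sum>v\<in>UNIV. w u v * (\<bar>x u + edge_sign u v * x v\<bar> * (\<bar>x u\<bar> + \<bar>x v\<bar>)))
      = (\<Sum>p\<in>UNIV \<times> UNIV. ?a p * ?b p)"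
    unfolding sum.cartesian_product
    by (intro sum.cong) (auto simp: weight_nonneg algebra_simps simp flip: mult.assoc)
  moreover have "(\<Sum>p\<in>UNIV \<times> UNIV. (?a p)\<^sup>2) = 2 * energy x"
    unfolding energy_def sum.cartesian_product
    by (simp add: case_prod_unfold power_mult_distrib weight_nonneg)
  moreover have "(\<Sum>p\<in>UNIV \<times> UNIV. (?b p)\<^sup>2) \<le> 4 * (\<Sum>u\<in>UNIV. wdegree w u * (x u)\<^sup>2)"
  proof -
    have "(\<bar>x u\<bar> + \<bar>x v\<bar>)\<^sup>2 \<le> 2 * (x u)\<^sup>2 + 2 * (x v)\<^sup>2" for u v
      using sum_squares_bound[of "\<bar>x u\<bar>" "\<bar>x v\<bar>"] by (simp add: power2_sum)
    then have "(\<Sum>p\<in>UNIV \<times> UNIV. (?b p)\<^sup>2)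
        \<le> (\<Sum>(u, v)\<in>UNIV \<times> UNIV. w u v * (2 * (x u)\<^sup>2 + 2 * (x v)\<^sup>2))"
      by (intro sum_mono) (auto simp: power_mult_distrib weight_nonneg intro!: mult_left_mono)
    also have "\<dots> = 2 * (\<Sum>u\<in>UNIV. \<Sum>v\<in>UNIV. w u v * (x u)\<^sup>2) + 2 * (\<Sum>u\<in>UNIV. \<Sum>v\<in>UNIV. w u v * (x v)\<^sup>2)"
      unfolding sum.cartesian_product[symmetric] by (simp add: sum.distrib sum_distrib_left algebra_simps)
    also have "\<dots> = 4 * (\<Sum>u\<in>UNIV. wdegree w u * (x u)\<^sup>2)"
      by (simp add: sum_weight_power2 sum_weight_power2')
    finally show ?thesis .
  qed
  moreover have "0 \<le> energy x"
    by (simp add: energy_def sum_nonneg weight_nonneg)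
  ultimately show ?thesis
    using Cauchy_Schwarz_ineq_sum[of ?a ?b "UNIV \<times> UNIV"]
      mult_left_mono[of "\<Sum>p\<in>UNIV \<times> UNIV. (?b p)\<^sup>2" "4 * (\<Sum>u\<in>UNIV. wdegree w u * (x u)\<^sup>2)" "2 * energy x"]
    by simp
qed

section \<open>The dual Cheeger constant as an attained minimum\<close>

lemma dual_cheeger_set:
  defines "S \<equiv> {\<beta> E w (\<lambda>e. - \<sigma> e) (wdegree w) V1 V2 | V1 V2. V1 \<inter> V2 = {} \<and> V1 \<union> V2 \<noteq> {}}"
  shows "finite S" "S \<noteq> {}" "Min S = dual_signed_cheeger E w \<sigma> (wdegree w)"
proof -
  have "S \<subseteq> (\<lambda>(V1, V2). \<beta> E w (\<lambda>e. - \<sigma> e) (wdegree w) V1 V2) ` UNIV"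
    unfolding S_def by auto
  then show "finite S"
    by (rule finite_subset) simp
  have "\<beta> E w (\<lambda>e. - \<sigma> e) (wdegree w) UNIV {} \<in> S"
    unfolding S_def by auto
  then show "S \<noteq> {}"
    by blast
  show "Min S = dual_signed_cheeger E w \<sigma> (wdegree w)"
    by (simp add: S_def dual_signed_cheeger_def signed_cheeger_def)
qed

lemma vol_degree_pos: "V \<noteq> {} \<Longrightarrow> 0 < vol (wdegree w) V"
  unfolding vol_def using degree_pos by (intro sum_pos) auto

lemma dual_cheeger_le:
  assumes "V1 \<inter> V2 = {}" "V1 \<union> V2 \<noteq> {}"
  shows "dual_signed_cheeger E w \<sigma> (wdegree w) * vol (wdegree w) (V1 \<union> V2) \<le> frustration V1 V2"
proof -
  have "dual_signed_cheeger E w \<sigma> (wdegree w) \<le> \<beta> E w (\<lambda>e. - \<sigma> e) (wdegree w) V1 V2"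
    unfolding dual_cheeger_set(3)[symmetric]
    using assms by (intro Min_le dual_cheeger_set(1)) blast
  then show ?thesis
    unfolding \<beta>_def frustration_def[symmetric]
    using vol_degree_pos[OF assms(2)] by (simp add: pos_le_divide_eq)
qed

lemma dual_cheeger_attained:
  obtains V1 V2 where "V1 \<inter> V2 = {}" "V1 \<union> V2 \<noteq> {}"
    "dual_signed_cheeger E w \<sigma> (wdegree w) * vol (wdegree w) (V1 \<union> V2) = frustration V1 V2"
proof -
  obtain V1 V2 where V: "V1 \<inter> V2 = {}" "V1 \<union> V2 \<noteq> {}"
      "dual_signed_cheeger E w \<sigma> (wdegree w) = \<beta> E w (\<lambda>e. - \<sigma> e) (wdegree w) V1 V2"
    using Min_in[OF dual_cheeger_set(1,2)] unfolding dual_cheeger_set(3) by blast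
  moreover have "dual_signed_cheeger E w \<sigma> (wdegree w) * vol (wdegree w) (V1 \<union> V2) = frustration V1 V2"
    unfolding V(3) \<beta>_def frustration_def[symmetric] using vol_degree_pos[OF V(2)] by simp
  ultimately show thesis
    using that by blast
qed

end

theorem theorem1p6:
  fixes E :: "'v::finite set set"
    and w :: "'v \<Rightarrow> 'v \<Rightarrow> real"
    and \<sigma> :: "'v set \<Rightarrow> int"
  assumes "signed_graph E w \<sigma>"
  shows "(2 - eigval CARD('v) (signed_laplacian E w \<sigma>)) / 2
           \<le> dual_signed_cheeger E w \<sigma> (wdegree w)
       \<and> dual_signed_cheeger E w \<sigma> (wdegree w)
           \<le> sqrt (2 * (2 - eigval CARD('v) (signed_laplacian E w \<sigma>)))"
proof -
  interpret signed_graph E w \<sigma>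
    by fact
  let ?L = "signed_laplacian E w \<sigma>"
  let ?l = "eigval CARD('v) ?L"
  let ?h = "dual_signed_cheeger E w \<sigma> (wdegree w)"
  note rayleigh = rayleigh_le_eigval[OF symmetrizes_signed_laplacian]
  have "(2 - ?l) / 2 \<le> ?h"
  proof -
    obtain V1 V2 where V: "V1 \<inter> V2 = {}" "V1 \<union> V2 \<noteq> {}"
        "?h * vol (wdegree w) (V1 \<union> V2) = frustration V1 V2"
      by (rule dual_cheeger_attained)
    define z :: "real^'v" where "z = (\<chi> u. if u \<in> V1 then 1 else if u \<in> V2 then - 1 else 0)"
    have "(\<Sum>u\<in>UNIV. wdegree w u * (z $ u)\<^sup>2) = (\<Sum>u\<in>UNIV. if u \<in> V1 \<union> V2 then wdegree w u else 0)"
      by (intro sum.cong) (auto simp: z_def)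
    also have "\<dots> = vol (wdegree w) (V1 \<union> V2)"
      by (simp add: vol_def sum.If_cases del: Un_iff)
    \<comment> \<open>The squares of \<open>z\<close> form the indicator of the union, so the
      Rayleigh bound at \<open>z\<close> has the volume as its denominator.\<close>
    finally have "(2 - ?l) * vol (wdegree w) (V1 \<union> V2) \<le> energy (\<lambda>u. z $ u)"
      using rayleigh[of z] unfolding energy_eq by (simp add: left_diff_distrib)
    also have "\<dots> \<le> 2 * frustration V1 V2"
      using V(1) by (rule energy_le_frustration) (simp add: z_def)
    also have "\<dots> = 2 * ?h * vol (wdegree w) (V1 \<union> V2)"
      using V(3) by simp
    finally show ?thesis
      using vol_degree_pos[OF V(2)] by simp
  qed
  moreover have "?h \<le> sqrt (2 * (2 - ?l))"
  proof -
    obtain x where x: "x \<noteq> 0" "?L *v x = ?l *s x"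
      using symmetrizable_eigval(1)[OF symmetrizes_signed_laplacian] by blast
    define Q where "Q = (\<Sum>u\<in>UNIV. wdegree w u * (x $ u)\<^sup>2)"
    define R where "R = (\<Sum>u\<in>UNIV. \<Sum>v\<in>UNIV. w u v *
      (\<bar>x $ u + edge_sign u v * x $ v\<bar> * (\<bar>x $ u\<bar> + \<bar>x $ v\<bar>)))"
    obtain k where "x $ k \<noteq> 0"
      using x(1) by (auto simp: vec_eq_iff)
    then have "0 < Q"
      unfolding Q_def using degree_pos by (intro sum_pos2[of _ k]) (auto simp: less_imp_le)
    have "energy (\<lambda>u. x $ u) = (2 - ?l) * Q"
      unfolding energy_eq x(2) Q_def
      by (simp add: left_diff_distrib right_diff_distrib sum_subtractf sum_distrib_left
          power2_eq_square mult_ac)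
    then have "R\<^sup>2 \<le> 8 * ((2 - ?l) * Q) * Q"
      using sum_level_Cauchy_Schwarz[of "\<lambda>u. x $ u"] by (simp add: R_def Q_def)
    \<comment> \<open>Regrouped so that the square root splits off \<open>2 * Q\<close>; its 2
      matches the half in \<open>sum_level_bound\<close>.\<close>
    then have "R\<^sup>2 \<le> 2 * (2 - ?l) * (2 * Q)\<^sup>2"
      by (simp add: power2_eq_square mult_ac)
    then have "R \<le> sqrt (2 * (2 - ?l) * (2 * Q)\<^sup>2)"
      by (rule real_le_rsqrt)
    also have "\<dots> = sqrt (2 * (2 - ?l)) * (2 * Q)"
      using \<open>0 < Q\<close> by (simp add: real_sqrt_mult)
    finally have "R / 2 \<le> sqrt (2 * (2 - ?l)) * Q"
      by simp
    moreover have "?h * Q \<le> R / 2"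
      unfolding R_def Q_def using dual_cheeger_le by (rule sum_level_bound)
    ultimately have "?h * Q \<le> sqrt (2 * (2 - ?l)) * Q"
      by linarith
    then show ?thesis
      using \<open>0 < Q\<close> by (rule mult_right_le_imp_le)
  qed
  ultimately show ?thesis ..
qed

end
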